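(* Let $\mathcal{C}$ be a simplicial complex on ground set $[m]$ and $\mathbf{d}=(d_1,\dots,d_m)$ an integer vector with all $d_i\ge2$, and assume $\mathcal{A}_{\mathcal{C},\mathbf{d}}$ is normal. Let $v$ be a vertex of $\mathcal{C}$ and let $\mathbf{d}'$ be obtained from $\mathbf{d}$ by deleting $d_v$. Then $\mathcal{A}_{\mathrm{link}_v(\mathcal{C}),\mathbf{d}'}$ is normal.
   Context: The matrix $\mathcal{A}_{\mathcal{C},\mathbf{d}}$ has columns indexed by $\mathbf{i}\in\prod_{j\in[m]}[d_j]$ and rows indexed by pairs $(F,e)$ with $F$ a facet (inclusion-maximal face) of $\mathcal{C}$ and $e\in\prod_{j\in F}[d_j]$; the entry in row $(F,e)$, column $\mathbf{i}$ is $1$ if $e=(i_j:j\in F)$ and $0$ otherwise. A matrix $A$ with $n$ columns is normal if $\mathbb{R}_{\ge0}A\cap\mathbb{Z}A=\mathbb{N}A$ (cone, lattice and semigroup generated by the columns). The link of a vertex $v$ is $\mathrm{link}_v(\mathcal{C})=\{F\setminus\{v\}: F\in\mathcal{C},\ v\in F\}$, regarded as a complex on ground set $[m]\setminus\{v\}$. *)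

theory Defs
  imports Complex_Main "HOL-Library.FuncSet"
begin

text \<open>
  A simplicial complex on the ground set \<open>V\<close>. Elements of \<open>V\<close> need not be vertices of the
  complex (the link of \<open>v\<close> on ground set \<open>V - {v}\<close> may fail to contain some \<open>{w}\<close>).
\<close>

definition simplicial_complex :: "'a set \<Rightarrow> 'a set set \<Rightarrow> bool" where
  "simplicial_complex V C \<longleftrightarrow> C \<subseteq> Pow V \<and> (\<forall>F\<in>C. \<forall>G. G \<subseteq> F \<longrightarrow> G \<in> C)"

definition vertices :: "'a set set \<Rightarrow> 'a set" where
  "vertices C = {v. {v} \<in> C}"

definition facets :: "'a set set \<Rightarrow> 'a set set" where
  "facets C = {F \<in> C. \<forall>G\<in>C. F \<subseteq> G \<longrightarrow> G = F}"

definition link :: "'a \<Rightarrow> 'a set set \<Rightarrow> 'a set set" where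
  "link v C = {F - {v} | F. F \<in> C \<and> v \<in> F}"

lemma simplicial_complex_link:
  assumes "simplicial_complex V C"
  shows "simplicial_complex (V - {v}) (link v C)"
proof -
  have sub: "F \<subseteq> V" if "F \<in> C" for F
    using assms that by (auto simp: simplicial_complex_def)
  have down: "G \<in> C" if "F \<in> C" "G \<subseteq> F" for F G
    using assms that by (simp add: simplicial_complex_def)
  have "G \<in> link v C" if F: "F \<in> C" "v \<in> F" and G: "G \<subseteq> F - {v}" for F G
  proof -
    have "insert v G \<in> C" by (rule down[OF F(1)]) (use F G in auto)
    moreover have "G = insert v G - {v}" using G by auto
    ultimately show ?thesis unfolding link_def by auto
  qed
  moreover have "H \<subseteq> V - {v}" if "H \<in> link v C" for H
    using that sub by (auto simp: link_def)
  ultimately show ?thesis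
    by (auto simp: simplicial_complex_def link_def)
qed

text \<open>
  A real matrix with row set \<open>R\<close> and column set \<open>J\<close> is a function \<open>A\<close> of which only the values
  \<open>A r j\<close> with \<open>r \<in> R\<close>, \<open>j \<in> J\<close> are relevant. A vector of \<open>\<real>\<^sup>R\<close> is represented by a function
  that is \<open>undefined\<close> outside \<open>R\<close>.
\<close>

definition mat_vec :: "'r set \<Rightarrow> 'c set \<Rightarrow> ('r \<Rightarrow> 'c \<Rightarrow> real) \<Rightarrow> ('c \<Rightarrow> real) \<Rightarrow> 'r \<Rightarrow> real" where
  "mat_vec R J A x = (\<lambda>r\<in>R. \<Sum>j\<in>J. A r j * x j)"

definition column_cone :: "'r set \<Rightarrow> 'c set \<Rightarrow> ('r \<Rightarrow> 'c \<Rightarrow> real) \<Rightarrow> ('r \<Rightarrow> real) set" where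
  "column_cone R J A = {mat_vec R J A x | x. \<forall>j\<in>J. 0 \<le> x j}"

definition column_lattice :: "'r set \<Rightarrow> 'c set \<Rightarrow> ('r \<Rightarrow> 'c \<Rightarrow> real) \<Rightarrow> ('r \<Rightarrow> real) set" where
  "column_lattice R J A = {mat_vec R J A x | x. \<forall>j\<in>J. x j \<in> \<int>}"

definition column_semigroup :: "'r set \<Rightarrow> 'c set \<Rightarrow> ('r \<Rightarrow> 'c \<Rightarrow> real) \<Rightarrow> ('r \<Rightarrow> real) set" where
  "column_semigroup R J A = {mat_vec R J A x | x. \<forall>j\<in>J. x j \<in> \<nat>}"

definition normal_matrix :: "'r set \<Rightarrow> 'c set \<Rightarrow> ('r \<Rightarrow> 'c \<Rightarrow> real) \<Rightarrow> bool" where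
  "normal_matrix R J A \<longleftrightarrow> column_cone R J A \<inter> column_lattice R J A = column_semigroup R J A"

text \<open>
  The matrix of the hierarchical model of the complex \<open>C\<close> on ground set \<open>V\<close>; multi-indices
  are elements of extensional products \<open>\<Pi>\<^sub>E\<close>, so that \<open>restrict i F\<close> is \<open>(i\<^sub>j : j \<in> F)\<close>.
\<close>

definition model_cols :: "'a set \<Rightarrow> ('a \<Rightarrow> nat) \<Rightarrow> ('a \<Rightarrow> nat) set" where
  "model_cols V d = (\<Pi>\<^sub>E j\<in>V. {1..d j})"

definition model_rows :: "'a set set \<Rightarrow> ('a \<Rightarrow> nat) \<Rightarrow> ('a set \<times> ('a \<Rightarrow> nat)) set" where
  "model_rows C d = (SIGMA F:facets C. \<Pi>\<^sub>E j\<in>F. {1..d j})"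

definition model_matrix :: "'a set \<times> ('a \<Rightarrow> nat) \<Rightarrow> ('a \<Rightarrow> nat) \<Rightarrow> real" where
  "model_matrix = (\<lambda>(F, e) i. if e = restrict i F then 1 else 0)"

definition model_normal :: "'a set \<Rightarrow> 'a set set \<Rightarrow> ('a \<Rightarrow> nat) \<Rightarrow> bool" where
  "model_normal V C d \<longleftrightarrow> normal_matrix (model_rows C d) (model_cols V d) model_matrix"

end

theory Submission
  imports Defs
begin

text \<open>
  Let \<open>x'\<close> be real and nonnegative and \<open>y'\<close> integral with the same margins over the link. Take an
  integer \<open>N\<close> above all values of \<open>x'\<close>, and let \<open>x\<close> have the slices \<open>x'\<close>, \<open>N - x'\<close>, \<open>0\<close>, ..., \<open>0\<close>
  in direction \<open>v\<close>; define \<open>y\<close> from \<open>y'\<close> likewise. A margin of \<open>x\<close> over a facet containing \<open>v\<close> is a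
  margin of a single slice over a facet of the link, and a margin over a facet avoiding \<open>v\<close>
  depends only on the sum of the slices, which is the constant \<open>N\<close>. So \<open>x\<close> and \<open>y\<close> have the same
  margins over \<open>C\<close>. By normality these are the margins of some table \<open>z\<close> with entries in \<open>\<nat>\<close>, and
  the first slice of \<open>z\<close> has the link margins of \<open>x'\<close>.
\<close>

lemma mat_vec_eq_iff:
  "mat_vec R J A x = mat_vec R J A y \<longleftrightarrow> (\<forall>r\<in>R. (\<Sum>j\<in>J. A r j * x j) = (\<Sum>j\<in>J. A r j * y j))"
  unfolding mat_vec_def by (auto simp: fun_eq_iff restrict_def)

text \<open>Only one inclusion has content, since natural coefficients are at once nonnegative and
  integral. Stated with coefficient vectors, normality can be applied to explicit tables.\<close>

lemma normal_matrix_iff: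
  "normal_matrix R J A \<longleftrightarrow>
    (\<forall>x y. (\<forall>j\<in>J. 0 \<le> x j) \<longrightarrow> (\<forall>j\<in>J. y j \<in> \<int>) \<longrightarrow> mat_vec R J A x = mat_vec R J A y \<longrightarrow>
      (\<exists>z. (\<forall>j\<in>J. z j \<in> \<nat>) \<and> mat_vec R J A z = mat_vec R J A x))" (is "_ \<longleftrightarrow> ?R")
proof
  assume normal: "normal_matrix R J A"
  show ?R
  proof (intro allI impI)
    fix x y assume x: "\<forall>j\<in>J. 0 \<le> x j" and y: "\<forall>j\<in>J. y j \<in> \<int>"
      and eq: "mat_vec R J A x = mat_vec R J A y"
    have "mat_vec R J A x \<in> column_cone R J A" using x by (auto simp: column_cone_def)
    moreover have "mat_vec R J A x \<in> column_lattice R J A"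
      unfolding eq using y by (auto simp: column_lattice_def)
    ultimately have "mat_vec R J A x \<in> column_semigroup R J A"
      using normal by (auto simp: normal_matrix_def)
    then obtain z where "mat_vec R J A x = mat_vec R J A z" "\<forall>j\<in>J. z j \<in> \<nat>"
      unfolding column_semigroup_def by blast
    then show "\<exists>z. (\<forall>j\<in>J. z j \<in> \<nat>) \<and> mat_vec R J A z = mat_vec R J A x"
      by (intro exI[of _ z]) simp
  qed
next
  assume rep: ?R
  show "normal_matrix R J A"
    unfolding normal_matrix_def
  proof
    show "column_cone R J A \<inter> column_lattice R J A \<subseteq> column_semigroup R J A"
    proof
      fix b assume "b \<in> column_cone R J A \<inter> column_lattice R J A"
      then obtain x y where b: "b = mat_vec R J A x" "\<forall>j\<in>J. 0 \<le> x j"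
          "b = mat_vec R J A y" "\<forall>j\<in>J. y j \<in> \<int>"
        unfolding column_cone_def column_lattice_def by blast
      then obtain z where "\<forall>j\<in>J. z j \<in> \<nat>" "mat_vec R J A z = b"
        using rep by metis
      then show "b \<in> column_semigroup R J A" unfolding column_semigroup_def by blast
    qed
    show "column_semigroup R J A \<subseteq> column_cone R J A \<inter> column_lattice R J A"
      unfolding column_semigroup_def column_cone_def column_lattice_def
      by (auto simp: Nats_altdef2)
  qed
qed

text \<open>Inserting \<open>v\<close> is an inclusion-preserving bijection from the faces of the
  link to the faces of \<open>C\<close> through \<open>v\<close>. Every face above a face through
  \<open>v\<close> again contains \<open>v\<close>, so maximality carries over both ways.\<close>

lemma facets_link_iff:
  assumes "v \<notin> H"
  shows "H \<in> facets (link v C) \<longleftrightarrow> insert v H \<in> facets C"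
proof -
  have mem: "G \<in> link v C \<longleftrightarrow> v \<notin> G \<and> insert v G \<in> C" for G
  proof
    assume "v \<notin> G \<and> insert v G \<in> C"
    then have "G = insert v G - {v}" "insert v G \<in> C" "v \<in> insert v G" by auto
    then show "G \<in> link v C" unfolding link_def by blast
  qed (auto simp: link_def insert_absorb)
  show ?thesis
  proof
    assume H: "H \<in> facets (link v C)"
    show "insert v H \<in> facets C"
      unfolding facets_def
    proof (intro CollectI conjI ballI impI)
      show "insert v H \<in> C" using H by (simp add: facets_def mem)
      fix G assume G: "G \<in> C" "insert v H \<subseteq> G"
      then have "G - {v} \<in> link v C" "H \<subseteq> G - {v}"
        using assms by (auto simp: mem insert_absorb)
      then have "G - {v} = H" using H by (auto simp: facets_def)
      then show "G = insert v H" using G by blast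
    qed
  next
    assume H: "insert v H \<in> facets C"
    show "H \<in> facets (link v C)"
      unfolding facets_def
    proof (intro CollectI conjI ballI impI)
      show "H \<in> link v C" using H assms by (simp add: facets_def mem)
      fix G assume G: "G \<in> link v C" "H \<subseteq> G"
      then have "insert v G = insert v H" using H by (auto simp: facets_def mem)
      then show "G = H" using G(1) assms by (simp add: mem insert_ident)
    qed
  qed
qed

lemma model_cols_restrict: "model_cols W (restrict d W) = model_cols W d"
  unfolding model_cols_def by (rule PiE_cong) simp

lemma model_rows_restrict:
  assumes "C \<subseteq> Pow W"
  shows "model_rows C (restrict d W) = model_rows C d"
  unfolding model_rows_def
proof (rule Sigma_cong)
  fix F assume "F \<in> facets C"
  then have "F \<subseteq> W" using assms by (auto simp: facets_def)
  then show "(\<Pi>\<^sub>E j\<in>F. {1..restrict d W j}) = (\<Pi>\<^sub>E j\<in>F. {1..d j})"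
    by (intro PiE_cong) auto
qed simp

lemma finite_model_cols: "finite V \<Longrightarrow> finite (model_cols V d)"
  unfolding model_cols_def by (intro finite_PiE) auto

lemma fun_upd_mem_model_cols:
  assumes "v \<in> V" "g \<in> model_cols (V - {v}) d" "k \<in> {1..d v}"
  shows "g(v := k) \<in> model_cols V d"
  using PiE_fun_upd[of k "\<lambda>j. {1..d j}" v g "V - {v}"] assms
  by (simp add: model_cols_def insert_absorb)

lemma model_cols_slice:
  assumes "v \<in> V" "i \<in> model_cols V d"
  shows "i(v := undefined) \<in> model_cols (V - {v}) d" "i v \<in> {1..d v}"
  using assms by (auto simp: model_cols_def PiE_iff extensional_def)

text \<open>A multi-index splits uniquely into its coordinate at \<open>v\<close> and the rest;
  uniqueness uses that members of the smaller product are all \<open>undefined\<close> at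
  \<open>v\<close>.\<close>

lemma sum_model_cols_slices:
  fixes f :: "('a \<Rightarrow> nat) \<Rightarrow> real"
  assumes "v \<in> V"
  shows "(\<Sum>i\<in>model_cols V d. f i) = (\<Sum>k=1..d v. \<Sum>g\<in>model_cols (V - {v}) d. f (g(v := k)))"
proof -
  have "model_cols V d = (\<lambda>(k, g). g(v := k)) ` ({1..d v} \<times> model_cols (V - {v}) d)"
    using PiE_insert_eq[of v "V - {v}" "\<lambda>j. {1..d j}"] assms
    by (simp add: model_cols_def insert_absorb)
  moreover have "inj_on (\<lambda>(k, g). g(v := k)) ({1..d v} \<times> model_cols (V - {v}) d)"
    using inj_combinator[of v "V - {v}" "\<lambda>j. {1..d j}"] by (simp add: model_cols_def)
  ultimately show ?thesis
    by (simp add: sum.reindex sum.cartesian_product split_def)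
qed

text \<open>The row \<open>(insert v H, e(v := k))\<close> vanishes on every column whose coordinate
  at \<open>v\<close> differs from \<open>k\<close>, so only slice \<open>k\<close>
  contributes.\<close>

lemma margin_insert:
  assumes "v \<in> V" "v \<notin> H" "e \<in> extensional H" "k \<in> {1..d v}"
  shows "(\<Sum>i\<in>model_cols V d. model_matrix (insert v H, e(v := k)) i * x i) =
    (\<Sum>g\<in>model_cols (V - {v}) d. model_matrix (H, e) g * x (g(v := k)))"
proof -
  have eq: "e(v := k) = restrict (g(v := l)) (insert v H) \<longleftrightarrow> l = k \<and> e = restrict g H" for g l
    using assms(2,3) by (auto simp: fun_eq_iff restrict_def extensional_def)
  have "(\<Sum>i\<in>model_cols V d. model_matrix (insert v H, e(v := k)) i * x i) =
    (\<Sum>l=1..d v. if l = k then \<Sum>g\<in>model_cols (V - {v}) d. model_matrix (H, e) g * x (g(v := k)) else 0)"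
    unfolding sum_model_cols_slices[OF assms(1)]
    by (rule sum.cong) (auto simp: model_matrix_def eq)
  then show ?thesis using assms(4) by simp
qed

text \<open>The entries of such a row do not depend on the coordinate at \<open>v\<close>, so the
  slices may be summed first.\<close>

lemma margin_avoiding:
  assumes "v \<in> V" "v \<notin> F"
  shows "(\<Sum>i\<in>model_cols V d. model_matrix (F, e) i * x i) =
    (\<Sum>g\<in>model_cols (V - {v}) d. model_matrix (F, e) g * (\<Sum>k=1..d v. x (g(v := k))))"
proof -
  have eq: "model_matrix (F, e) (g(v := k)) = model_matrix (F, e) g" for g k
    using assms(2) by (simp add: model_matrix_def)
  then show ?thesis
    unfolding sum_model_cols_slices[OF assms(1)] sum_distrib_left
    by (simp only: eq) (rule sum.swap)
qed

text \<open>
  The multi-index \<open>i(v := undefined)\<close> is the restriction of \<open>i\<close> to the ground set without \<open>v\<close>.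
\<close>

definition complementary_lift :: "'a \<Rightarrow> real \<Rightarrow> (('a \<Rightarrow> nat) \<Rightarrow> real) \<Rightarrow> ('a \<Rightarrow> nat) \<Rightarrow> real" where
  "complementary_lift v N x i =
    (if i v = 1 then x (i(v := undefined)) else if i v = 2 then N - x (i(v := undefined)) else 0)"

lemma complementary_lift_fun_upd:
  assumes "g \<in> model_cols (V - {v}) d"
  shows "complementary_lift v N x (g(v := k)) = (if k = 1 then x g else if k = 2 then N - x g else 0)"
proof -
  have "g v = undefined" using assms by (auto simp: model_cols_def PiE_iff extensional_def)
  then show ?thesis by (simp add: complementary_lift_def fun_upd_idem)
qed

lemma sum_complementary_lift:
  assumes "g \<in> model_cols (V - {v}) d" "2 \<le> d v"
  shows "(\<Sum>k=1..d v. complementary_lift v N x (g(v := k))) = N"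
proof -
  \<comment> \<open>Because \<open>2 \<le> d v\<close>, both nonzero slices occur in the
    sum.\<close>
  have "(\<Sum>k=1..d v. complementary_lift v N x (g(v := k))) =
      (\<Sum>k\<in>{1, 2}. complementary_lift v N x (g(v := k)))"
    using assms by (intro sum.mono_neutral_right) (auto simp: complementary_lift_fun_upd)
  then show ?thesis using assms(1) by (simp add: complementary_lift_fun_upd)
qed

lemma mat_vec_complementary_lift:
  assumes "v \<in> V" "2 \<le> d v"
    and "mat_vec (model_rows (link v C) d) (model_cols (V - {v}) d) model_matrix x =
      mat_vec (model_rows (link v C) d) (model_cols (V - {v}) d) model_matrix y"
  shows "mat_vec (model_rows C d) (model_cols V d) model_matrix (complementary_lift v N x) =
    mat_vec (model_rows C d) (model_cols V d) model_matrix (complementary_lift v N y)"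
  unfolding mat_vec_eq_iff
proof
  fix r assume "r \<in> model_rows C d"
  then obtain F e where r: "r = (F, e)" and F: "F \<in> facets C" and e: "e \<in> (\<Pi>\<^sub>E j\<in>F. {1..d j})"
    by (auto simp: model_rows_def)
  let ?J = "model_cols (V - {v}) d"
  show "(\<Sum>i\<in>model_cols V d. model_matrix r i * complementary_lift v N x i) =
    (\<Sum>i\<in>model_cols V d. model_matrix r i * complementary_lift v N y i)"
  proof (cases "v \<in> F")
    case False
    then show ?thesis
      unfolding r margin_avoiding[OF assms(1) False] by (simp add: sum_complementary_lift assms(2) del: One_nat_def)
  next
    case True
    define H where "H = F - {v}"
    \<comment> \<open>Resetting \<open>v\<close> makes \<open>e'\<close> extensional on
      \<open>H\<close>, so that \<open>(H, e')\<close> is a row index of the link matrix.\<close>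
    define e' where "e' = e(v := undefined)"
    have H: "v \<notin> H" "F = insert v H" using True by (auto simp: H_def)
    have e': "e' \<in> (\<Pi>\<^sub>E j\<in>H. {1..d j})" "e = e'(v := e v)"
      using e H by (auto simp: e'_def PiE_iff extensional_def)
    have k: "e v \<in> {1..d v}" using e True by blast
    have "(H, e') \<in> model_rows (link v C) d"
      using F H e' by (simp add: model_rows_def facets_link_iff)
    then have xy: "(\<Sum>g\<in>?J. model_matrix (H, e') g * x g) = (\<Sum>g\<in>?J. model_matrix (H, e') g * y g)"
      using assms(3) unfolding mat_vec_eq_iff by blast
    \<comment> \<open>In each case the right-hand side depends on \<open>w\<close> only through its
      link margin at \<open>(H, e')\<close>, which agrees for \<open>x\<close> and
      \<open>y\<close>.\<close>
    have margin: "(\<Sum>i\<in>model_cols V d. model_matrix r i * complementary_lift v N w i) =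
      (if e v = 1 then \<Sum>g\<in>?J. model_matrix (H, e') g * w g
       else if e v = 2 then (\<Sum>g\<in>?J. model_matrix (H, e') g * N) - (\<Sum>g\<in>?J. model_matrix (H, e') g * w g)
       else 0)" for w
    proof -
      have "(\<Sum>i\<in>model_cols V d. model_matrix r i * complementary_lift v N w i) =
        (\<Sum>g\<in>?J. model_matrix (H, e') g * complementary_lift v N w (g(v := e v)))"
        using margin_insert[where d = d and e = e' and k = "e v", OF assms(1) H(1) _ k] e' H(2) by (simp add: r PiE_iff)
      then show ?thesis
        by (simp add: complementary_lift_fun_upd right_diff_distrib sum_subtractf)
    qed
    show ?thesis by (simp only: margin xy)
  qed
qed

text \<open>Converse direction to the lift: each link margin of slice \<open>k\<close> is itself a
  margin over a facet of \<open>C\<close> through \<open>v\<close>, with \<open>v\<close>-coordinate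
  \<open>k\<close>.\<close>

lemma mat_vec_slice:
  assumes "v \<in> V" "k \<in> {1..d v}" "\<And>F. F \<in> link v C \<Longrightarrow> v \<notin> F"
    and "mat_vec (model_rows C d) (model_cols V d) model_matrix x =
      mat_vec (model_rows C d) (model_cols V d) model_matrix y"
  shows "mat_vec (model_rows (link v C) d) (model_cols (V - {v}) d) model_matrix (\<lambda>g. x (g(v := k))) =
    mat_vec (model_rows (link v C) d) (model_cols (V - {v}) d) model_matrix (\<lambda>g. y (g(v := k)))"
  unfolding mat_vec_eq_iff
proof
  fix r assume "r \<in> model_rows (link v C) d"
  then obtain H e where r: "r = (H, e)" and H: "H \<in> facets (link v C)"
    and e: "e \<in> (\<Pi>\<^sub>E j\<in>H. {1..d j})"
    by (auto simp: model_rows_def)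
  have v: "v \<notin> H" using H assms(3) by (auto simp: facets_def)
  have "(insert v H, e(v := k)) \<in> model_rows C d"
    using H e v assms(2) PiE_fun_upd[of k "\<lambda>j. {1..d j}" v e H]
    by (simp add: model_rows_def facets_link_iff)
  then have "(\<Sum>i\<in>model_cols V d. model_matrix (insert v H, e(v := k)) i * x i) =
      (\<Sum>i\<in>model_cols V d. model_matrix (insert v H, e(v := k)) i * y i)"
    using assms(4) unfolding mat_vec_eq_iff by blast
  then show "(\<Sum>g\<in>model_cols (V - {v}) d. model_matrix r g * x (g(v := k))) =
      (\<Sum>g\<in>model_cols (V - {v}) d. model_matrix r g * y (g(v := k)))"
    using margin_insert[where d = d and e = e and k = k, OF assms(1) v _ assms(2)] e by (simp add: r PiE_iff)
qed

lemma model_normal_link: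
  assumes "finite V" "v \<in> V" "2 \<le> d v" "model_normal V C d"
  shows "model_normal (V - {v}) (link v C) d"
  unfolding model_normal_def normal_matrix_iff
proof (intro allI impI)
  let ?J = "model_cols (V - {v}) d"
  let ?M = "mat_vec (model_rows C d) (model_cols V d) model_matrix"
  let ?M' = "mat_vec (model_rows (link v C) d) ?J model_matrix"
  fix x y assume x: "\<forall>g\<in>?J. 0 \<le> x g" and y: "\<forall>g\<in>?J. y g \<in> \<int>" and xy: "?M' x = ?M' y"
  \<comment> \<open>The entries of \<open>x\<close> are nonnegative, so their sum bounds each of
    them and slice 2 of the lift of \<open>x\<close> is nonnegative. Rounding up to an integer keeps
    the lift of \<open>y\<close> integral.\<close>
  define N :: real where "N = of_int \<lceil>\<Sum>g\<in>?J. x g\<rceil>"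
  have fin: "finite ?J" using assms(1) by (simp add: finite_model_cols)
  have le_N: "x g \<le> N" if "g \<in> ?J" for g
    using member_le_sum[OF that, of x] x fin unfolding N_def by (smt (verit) DiffE le_of_int_ceiling)
  have "\<forall>i\<in>model_cols V d. 0 \<le> complementary_lift v N x i"
    using x le_N model_cols_slice(1)[OF assms(2)] by (auto simp: complementary_lift_def)
  moreover have "\<forall>i\<in>model_cols V d. complementary_lift v N y i \<in> \<int>"
    using y model_cols_slice(1)[OF assms(2)] by (auto simp: complementary_lift_def N_def)
  moreover have "?M (complementary_lift v N x) = ?M (complementary_lift v N y)"
    using assms(2,3) xy by (rule mat_vec_complementary_lift)
  ultimately obtain z where z: "\<forall>i\<in>model_cols V d. z i \<in> \<nat>"
      and Mz: "?M z = ?M (complementary_lift v N x)"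
    using assms(4) unfolding model_normal_def normal_matrix_iff by blast
  have one: "1 \<in> {1..d v}" using assms(3) by simp
  \<comment> \<open>Slice 1 is the one in which the lift carries \<open>x\<close> itself rather than
    its complement.\<close>
  have "?M' (\<lambda>g. z (g(v := 1))) = ?M' (\<lambda>g. complementary_lift v N x (g(v := 1)))"
    using assms(2) one _ Mz by (rule mat_vec_slice) (auto simp: link_def)
  also have "\<dots> = ?M' x"
    unfolding mat_vec_eq_iff by (simp add: complementary_lift_fun_upd)
  finally have "?M' (\<lambda>g. z (g(v := 1))) = ?M' x" .
  moreover have "\<forall>g\<in>?J. z (g(v := 1)) \<in> \<nat>"
    using z fun_upd_mem_model_cols[where d = d, OF assms(2) _ one] by blast
  ultimately show "\<exists>z. (\<forall>g\<in>?J. z g \<in> \<nat>) \<and> ?M' z = ?M' x"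
    by (intro exI[of _ "\<lambda>g. z (g(v := 1))"] conjI)
qed

theorem theorem4p10:
  fixes m :: nat and C :: "nat set set" and d :: "nat \<Rightarrow> nat" and v :: nat
  assumes "simplicial_complex {1..m} C"
    and "\<forall>i\<in>{1..m}. 2 \<le> d i"
    and "model_normal {1..m} C d"
    and "v \<in> vertices C"
  shows "model_normal ({1..m} - {v}) (link v C) (restrict d ({1..m} - {v}))"
proof -
  have v: "v \<in> {1..m}"
    using assms(1,4) by (auto simp: simplicial_complex_def vertices_def)
  \<comment> \<open>All faces of the link avoid \<open>v\<close>, so neither its rows nor the
    columns over the smaller ground set consult \<open>d v\<close>: \<open>d\<close> and its
    restriction give the same matrix.\<close>
  have "link v C \<subseteq> Pow ({1..m} - {v})"
    using simplicial_complex_link[OF assms(1)] by (simp add: simplicial_complex_def)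
  moreover have "model_normal ({1..m} - {v}) (link v C) d"
    using v assms(2,3) by (intro model_normal_link) auto
  ultimately show ?thesis
    unfolding model_normal_def by (simp only: model_cols_restrict model_rows_restrict)
qed

end
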